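(* Let $E$ be a finite semilattice and let $G$ be a group acting on the left on $E$ via the homomorphism $\theta\colon G\to \mathrm{Aut}(E)$. Then the following conditions are equivalent: (i) the semidirect product $E\ast_\theta G$ is a Howson inverse semigroup; (ii) $G$ is a Howson group.
   Context: A semilattice is a (nonempty) meet-semilattice $(E,\wedge)$, and $\mathrm{Aut}(E)$ is its group of semilattice automorphisms. A left action of a group $G$ on $E$ is a group homomorphism $\theta\colon G\to\mathrm{Aut}(E)$, $g\mapsto\theta_g$; write $g\cdot e=\theta_g(e)$. The semidirect product $E\ast_\theta G$ is the set $E\times G$ with multiplication $(e,g)(f,h)=(e\wedge(g\cdot f),gh)$; it is an inverse semigroup with $(e,g)^{-1}=(g^{-1}\cdot e,g^{-1})$. A group is a Howson group if the intersection of any two of its finitely generated subgroups is finitely generated. An inverse semigroup $S$ is a Howson inverse semigroup if the intersection of any two finitely generated inverse subsemigroups of $S$ is finitely generated (as an inverse semigroup); an empty intersection counts as finitely generated (by the empty set). *)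

theory Defs
  imports "HOL-Algebra.Algebra"
begin

subsection \<open>Semilattice automorphisms\<close>

definition semilattice_auto :: "('e, 'm) gorder_scheme \<Rightarrow> ('e \<Rightarrow> 'e) set"
  where "semilattice_auto E =
    {f \<in> Bij (carrier E). \<forall>x \<in> carrier E. \<forall>y \<in> carrier E. f (x \<sqinter>\<^bsub>E\<^esub> y) = f x \<sqinter>\<^bsub>E\<^esub> f y}"

definition Semilattice_Aut :: "('e, 'm) gorder_scheme \<Rightarrow> ('e \<Rightarrow> 'e) monoid"
  where "Semilattice_Aut E = BijGroup (carrier E) \<lparr>carrier := semilattice_auto E\<rparr>"


subsection \<open>Inverse semigroups\<close>

text \<open>The library's monoid record is not used, since a semigroup has no distinguished unit.\<close>

record 'a semigroup_struct = "'a partial_object" +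
  sgmult :: "'a \<Rightarrow> 'a \<Rightarrow> 'a"  (infixl \<open>\<bullet>\<index>\<close> 70)

definition is_sginverse :: "('a, 'm) semigroup_struct_scheme \<Rightarrow> 'a \<Rightarrow> 'a \<Rightarrow> bool"
  where "is_sginverse S x y \<longleftrightarrow>
    y \<in> carrier S \<and> x \<bullet>\<^bsub>S\<^esub> y \<bullet>\<^bsub>S\<^esub> x = x \<and> y \<bullet>\<^bsub>S\<^esub> x \<bullet>\<^bsub>S\<^esub> y = y"

locale inverse_semigroup =
  fixes S (structure)
  assumes sg_closed: "\<lbrakk>x \<in> carrier S; y \<in> carrier S\<rbrakk> \<Longrightarrow> x \<bullet> y \<in> carrier S"
    and sg_assoc: "\<lbrakk>x \<in> carrier S; y \<in> carrier S; z \<in> carrier S\<rbrakk>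
      \<Longrightarrow> (x \<bullet> y) \<bullet> z = x \<bullet> (y \<bullet> z)"
    and sg_inverse: "x \<in> carrier S \<Longrightarrow> \<exists>!y. is_sginverse S x y"

definition sginv :: "('a, 'm) semigroup_struct_scheme \<Rightarrow> 'a \<Rightarrow> 'a"
  where "sginv S x = (THE y. is_sginverse S x y)"

definition inverse_subsemigroup :: "'a set \<Rightarrow> ('a, 'm) semigroup_struct_scheme \<Rightarrow> bool"
  where "inverse_subsemigroup T S \<longleftrightarrow>
    T \<subseteq> carrier S \<and> (\<forall>x \<in> T. \<forall>y \<in> T. x \<bullet>\<^bsub>S\<^esub> y \<in> T) \<and> (\<forall>x \<in> T. sginv S x \<in> T)"

text \<open>The empty set is an inverse subsemigroup, and it is finitely generated, by the empty set.\<close>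

inductive_set inverse_sg_generate :: "('a, 'm) semigroup_struct_scheme \<Rightarrow> 'a set \<Rightarrow> 'a set"
  for S and A where
    sg_incl: "x \<in> A \<Longrightarrow> x \<in> inverse_sg_generate S A"
  | sg_inv: "x \<in> inverse_sg_generate S A \<Longrightarrow> sginv S x \<in> inverse_sg_generate S A"
  | sg_mult: "\<lbrakk>x \<in> inverse_sg_generate S A; y \<in> inverse_sg_generate S A\<rbrakk>
      \<Longrightarrow> x \<bullet>\<^bsub>S\<^esub> y \<in> inverse_sg_generate S A"

definition fin_gen_inverse_subsemigroup ::
    "'a set \<Rightarrow> ('a, 'm) semigroup_struct_scheme \<Rightarrow> bool"
  where "fin_gen_inverse_subsemigroup T S \<longleftrightarrow>
    inverse_subsemigroup T S \<and>
    (\<exists>A. finite A \<and> A \<subseteq> carrier S \<and> T = inverse_sg_generate S A)"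

definition howson_inverse_semigroup :: "('a, 'm) semigroup_struct_scheme \<Rightarrow> bool"
  where "howson_inverse_semigroup S \<longleftrightarrow> inverse_semigroup S \<and>
    (\<forall>T U. fin_gen_inverse_subsemigroup T S \<and> fin_gen_inverse_subsemigroup U S
      \<longrightarrow> fin_gen_inverse_subsemigroup (T \<inter> U) S)"


subsection \<open>Howson groups\<close>

definition fin_gen_subgroup :: "'a set \<Rightarrow> ('a, 'm) monoid_scheme \<Rightarrow> bool"
  where "fin_gen_subgroup H G \<longleftrightarrow>
    subgroup H G \<and>
    (\<exists>A. finite A \<and> A \<subseteq> carrier G \<and> H = generate G A)"

definition howson_group :: "('a, 'm) monoid_scheme \<Rightarrow> bool"
  where "howson_group G \<longleftrightarrow> group G \<and>
    (\<forall>H K. fin_gen_subgroup H G \<and> fin_gen_subgroup K G \<longrightarrow> fin_gen_subgroup (H \<inter> K) G)"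


subsection \<open>Semidirect products\<close>

definition semidirect_product ::
    "('e, 'm) gorder_scheme \<Rightarrow> ('g \<Rightarrow> 'e \<Rightarrow> 'e) \<Rightarrow> ('g, 'n) monoid_scheme
      \<Rightarrow> ('e \<times> 'g) semigroup_struct"
  where "semidirect_product E \<theta> G =
    \<lparr>carrier = carrier E \<times> carrier G,
     sgmult = (\<lambda>(e, g) (f, h). (e \<sqinter>\<^bsub>E\<^esub> \<theta> g f, g \<otimes>\<^bsub>G\<^esub> h))\<rparr>"

end

theory Submission
  imports Defs
begin

text \<open>
  View an inverse subsemigroup \<open>T\<close> of \<open>E \<times> G\<close> as a groupoid on the idempotents
  \<open>(e, 1) \<in> T\<close>, where \<open>(e, g)\<close> is an arrow from \<open>g\<^sup>-\<^sup>1e\<close> to \<open>e\<close>. Since \<open>E\<close> is finite, \<open>T\<close> is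
  finitely generated exactly when all its vertex groups \<open>T\<^sub>e = {g. (e, g) \<in> T, ge = e}\<close> are: one
  direction chooses one arrow between any two connected vertices, the other is a Schreier argument.
  As \<open>(T \<inter> U)\<^sub>e = T\<^sub>e \<inter> U\<^sub>e\<close>, the Howson property passes from \<open>G\<close> to \<open>E \<times> G\<close>. Conversely, the
  minimum \<open>\<bottom>\<close> of \<open>E\<close> is fixed by \<open>G\<close>, so \<open>H \<mapsto> {\<bottom>} \<times> H\<close> embeds the subgroups of \<open>G\<close>.
\<close>

section \<open>Generating sets\<close>

text \<open>As a group the empty set generates the trivial subgroup, as an inverse semigroup it
  generates the empty set. Adjoining the identity removes this mismatch before generators are
  carried from \<open>G\<close> to the semidirect product.\<close>

lemma (in group) fin_gen_subgroup_nonempty_generators: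
  assumes "fin_gen_subgroup H G"
  obtains A where "finite A" "A \<noteq> {}" "A \<subseteq> carrier G" "H = generate G A"
proof -
  obtain A where A: "finite A" "A \<subseteq> carrier G" "H = generate G A"
    using assms unfolding fin_gen_subgroup_def by blast
  have "generate G (insert \<one> A) \<subseteq> generate G A"
    using generate_subgroup_incl[OF _ generate_is_subgroup[OF A(2)], of "insert \<one> A"]
    by (auto intro: generate.one generate.incl)
  moreover have "generate G A \<subseteq> generate G (insert \<one> A)"
    by (rule mono_generate) auto
  ultimately have "H = generate G (insert \<one> A)"
    using A(3) by blast
  with A that[of "insert \<one> A"] show ?thesis
    by auto
qed

lemma inverse_sg_generate_subset:
  assumes "inverse_subsemigroup T S" "A \<subseteq> T"
  shows "inverse_sg_generate S A \<subseteq> T"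
proof
  fix x assume "x \<in> inverse_sg_generate S A"
  then show "x \<in> T"
    by induction (use assms in \<open>auto simp: inverse_subsemigroup_def\<close>)
qed

lemma inverse_sg_generate_mono:
  assumes "A \<subseteq> B"
  shows "inverse_sg_generate S A \<subseteq> inverse_sg_generate S B"
proof
  fix x assume "x \<in> inverse_sg_generate S A"
  then show "x \<in> inverse_sg_generate S B"
    by induction (use assms in \<open>auto intro: inverse_sg_generate.intros\<close>)
qed

section \<open>Group actions by semilattice automorphisms\<close>

locale semilattice_action = E: lower_semilattice E + G: group G
  for E :: "('e, 'm) gorder_scheme" and G :: "('g, 'n) monoid_scheme" +
  fixes \<theta> :: "'g \<Rightarrow> 'e \<Rightarrow> 'e"
  assumes action_hom: "\<theta> \<in> hom G (Semilattice_Aut E)"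
begin

lemma action_auto: "g \<in> carrier G \<Longrightarrow> \<theta> g \<in> semilattice_auto E"
  using action_hom by (auto simp: hom_def Semilattice_Aut_def)

lemma action_bij: "g \<in> carrier G \<Longrightarrow> bij_betw (\<theta> g) (carrier E) (carrier E)"
  using action_auto by (auto simp: semilattice_auto_def Bij_def)

lemma action_closed [simp, intro]:
  "\<lbrakk>g \<in> carrier G; e \<in> carrier E\<rbrakk> \<Longrightarrow> \<theta> g e \<in> carrier E"
  using action_bij bij_betwE by blast

lemma action_meet:
  "\<lbrakk>g \<in> carrier G; e \<in> carrier E; f \<in> carrier E\<rbrakk> \<Longrightarrow> \<theta> g (e \<sqinter>\<^bsub>E\<^esub> f) = \<theta> g e \<sqinter>\<^bsub>E\<^esub> \<theta> g f"
  using action_auto by (auto simp: semilattice_auto_def)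

lemma action_mult:
  assumes "g \<in> carrier G" "h \<in> carrier G" "e \<in> carrier E"
  shows "\<theta> (g \<otimes>\<^bsub>G\<^esub> h) e = \<theta> g (\<theta> h e)"
proof -
  have "\<theta> g \<in> Bij (carrier E)" "\<theta> h \<in> Bij (carrier E)"
    using assms action_auto by (auto simp: semilattice_auto_def)
  moreover have "\<theta> (g \<otimes>\<^bsub>G\<^esub> h) = \<theta> g \<otimes>\<^bsub>Semilattice_Aut E\<^esub> \<theta> h"
    using action_hom assms by (auto simp: hom_def)
  ultimately show ?thesis
    using assms by (simp add: Semilattice_Aut_def BijGroup_def compose_def)
qed

text \<open>Multiplicativity makes the action of the identity idempotent, and an injective
  idempotent map is the identity. This argument avoids showing that \<open>Semilattice_Aut E\<close>
  is a group.\<close>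

lemma action_one [simp]:
  assumes "e \<in> carrier E"
  shows "\<theta> \<one>\<^bsub>G\<^esub> e = e"
proof -
  have "\<theta> \<one>\<^bsub>G\<^esub> (\<theta> \<one>\<^bsub>G\<^esub> e) = \<theta> \<one>\<^bsub>G\<^esub> e"
    using action_mult[of "\<one>\<^bsub>G\<^esub>" "\<one>\<^bsub>G\<^esub>" e] assms by simp
  with action_bij[of "\<one>\<^bsub>G\<^esub>"] assms show ?thesis
    by (meson G.one_closed action_closed bij_betw_imp_inj_on inj_on_eq_iff)
qed

lemma action_inv_left [simp]:
  "\<lbrakk>g \<in> carrier G; e \<in> carrier E\<rbrakk> \<Longrightarrow> \<theta> (inv\<^bsub>G\<^esub> g) (\<theta> g e) = e"
  using action_mult[of "inv\<^bsub>G\<^esub> g" g e] by simp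

lemma action_inv_right [simp]:
  "\<lbrakk>g \<in> carrier G; e \<in> carrier E\<rbrakk> \<Longrightarrow> \<theta> g (\<theta> (inv\<^bsub>G\<^esub> g) e) = e"
  using action_mult[of g "inv\<^bsub>G\<^esub> g" e] by simp

text \<open>Automorphisms are defined by preservation of meets; this bridge to the order makes them
  monotone.\<close>

lemma le_iff_meet_eq:
  assumes "e \<in> carrier E" "f \<in> carrier E"
  shows "e \<sqsubseteq>\<^bsub>E\<^esub> f \<longleftrightarrow> e \<sqinter>\<^bsub>E\<^esub> f = e"
proof
  assume "e \<sqsubseteq>\<^bsub>E\<^esub> f"
  with assms show "e \<sqinter>\<^bsub>E\<^esub> f = e"
    by (intro E.le_antisym) (auto intro: E.meet_left E.meet_le)
next
  assume "e \<sqinter>\<^bsub>E\<^esub> f = e"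
  with E.meet_right[OF assms] show "e \<sqsubseteq>\<^bsub>E\<^esub> f"
    by simp
qed

lemma meet_idem [simp]: "e \<in> carrier E \<Longrightarrow> e \<sqinter>\<^bsub>E\<^esub> e = e"
  using le_iff_meet_eq[of e e] by simp

lemma meet_assoc:
  "\<lbrakk>a \<in> carrier E; b \<in> carrier E; c \<in> carrier E\<rbrakk>
    \<Longrightarrow> a \<sqinter>\<^bsub>E\<^esub> b \<sqinter>\<^bsub>E\<^esub> c = a \<sqinter>\<^bsub>E\<^esub> (b \<sqinter>\<^bsub>E\<^esub> c)"
  using E.weak_meet_assoc E.eq_is_equal by simp

lemma action_mono:
  assumes "g \<in> carrier G" "e \<in> carrier E" "f \<in> carrier E" "e \<sqsubseteq>\<^bsub>E\<^esub> f"
  shows "\<theta> g e \<sqsubseteq>\<^bsub>E\<^esub> \<theta> g f"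
  using assms le_iff_meet_eq action_meet action_closed by metis

lemma action_le_iff:
  assumes "g \<in> carrier G" "e \<in> carrier E" "f \<in> carrier E"
  shows "e \<sqsubseteq>\<^bsub>E\<^esub> \<theta> g f \<longleftrightarrow> \<theta> (inv\<^bsub>G\<^esub> g) e \<sqsubseteq>\<^bsub>E\<^esub> f"
  using assms action_mono[of g "\<theta> (inv\<^bsub>G\<^esub> g) e" f] action_mono[of "inv\<^bsub>G\<^esub> g" e "\<theta> g f"]
  by auto

text \<open>Used to pass from generators that fix \<open>e\<close> to the whole subgroup they
  generate.\<close>

lemma stabilizer_subgroup:
  assumes "e \<in> carrier E"
  shows "subgroup {g \<in> carrier G. \<theta> g e = e} G"
proof (rule G.subgroupI)
  show "{g \<in> carrier G. \<theta> g e = e} \<noteq> {}"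
    using assms action_one by blast
next
  fix g assume "g \<in> {g \<in> carrier G. \<theta> g e = e}"
  then show "inv\<^bsub>G\<^esub> g \<in> {g \<in> carrier G. \<theta> g e = e}"
    using action_inv_left[of g e] assms by auto
qed (use assms in \<open>auto simp: action_mult\<close>)

text \<open>A finite nonempty semilattice has a least element \<open>b\<close>. Minimality gives
  \<open>b\<close> below both its image under \<open>g\<close> and its image under the inverse of
  \<open>g\<close>; applying \<open>g\<close> to the latter inequality gives the converse of the
  former.\<close>

lemma fixed_bottom:
  assumes "carrier E \<noteq> {}" "finite (carrier E)"
  obtains b where "b \<in> carrier E" "\<And>g. g \<in> carrier G \<Longrightarrow> \<theta> g b = b"
proof -
  have gr: "greatest E (\<Sqinter>\<^bsub>E\<^esub>carrier E) (Lower E (carrier E))"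
    using assms by (intro E.finite_inf_greatest) auto
  define b where "b = \<Sqinter>\<^bsub>E\<^esub>carrier E"
  have b: "b \<in> carrier E"
    using gr by (auto simp: b_def greatest_def Lower_def)
  have least: "b \<sqsubseteq>\<^bsub>E\<^esub> e" if "e \<in> carrier E" for e
    using gr that by (simp add: b_def greatest_def Lower_def)
  have "\<theta> g b = b" if g: "g \<in> carrier G" for g
  proof (rule E.le_antisym)
    have "b \<sqsubseteq>\<^bsub>E\<^esub> \<theta> (inv\<^bsub>G\<^esub> g) b"
      using g b by (intro least) auto
    with g b show "\<theta> g b \<sqsubseteq>\<^bsub>E\<^esub> b"
      using action_mono[of g b "\<theta> (inv\<^bsub>G\<^esub> g) b"] by simp
  qed (use g b least in auto)
  with b that show ?thesis by blast
qed

section \<open>The semidirect product as an inverse semigroup\<close>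

abbreviation S where "S \<equiv> semidirect_product E \<theta> G"

lemma carrier_semidirect [simp]: "carrier S = carrier E \<times> carrier G"
  by (simp add: semidirect_product_def)

lemma mult_semidirect [simp]: "(e, g) \<bullet>\<^bsub>S\<^esub> (f, h) = (e \<sqinter>\<^bsub>E\<^esub> \<theta> g f, g \<otimes>\<^bsub>G\<^esub> h)"
  by (simp add: semidirect_product_def)

text \<open>Cancellation in \<open>G\<close> forces the second coordinate \<open>h\<close> of an
  inverse \<open>(f, h)\<close>. The two defining equations then bound \<open>e\<close> by
  \<open>\<theta> g f\<close> and \<open>f\<close> by \<open>\<theta> h e\<close>, and antisymmetry
  determines \<open>f\<close>.\<close>

lemma is_sginverse_semidirect_iff:
  assumes "e \<in> carrier E" "g \<in> carrier G"
  shows "is_sginverse S (e, g) y \<longleftrightarrow> y = (\<theta> (inv\<^bsub>G\<^esub> g) e, inv\<^bsub>G\<^esub> g)"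
proof
  assume "y = (\<theta> (inv\<^bsub>G\<^esub> g) e, inv\<^bsub>G\<^esub> g)"
  with assms show "is_sginverse S (e, g) y"
    by (simp add: is_sginverse_def)
next
  assume inv: "is_sginverse S (e, g) y"
  obtain f h where y: "y = (f, h)" by (cases y)
  have f: "f \<in> carrier E" and h: "h \<in> carrier G"
    and 1: "e \<sqinter>\<^bsub>E\<^esub> \<theta> g f \<sqinter>\<^bsub>E\<^esub> \<theta> (g \<otimes>\<^bsub>G\<^esub> h) e = e" and gh: "g \<otimes>\<^bsub>G\<^esub> h \<otimes>\<^bsub>G\<^esub> g = g"
    and 2: "f \<sqinter>\<^bsub>E\<^esub> \<theta> h e \<sqinter>\<^bsub>E\<^esub> \<theta> (h \<otimes>\<^bsub>G\<^esub> g) f = f"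
    using inv by (auto simp: y is_sginverse_def)
  have "g \<otimes>\<^bsub>G\<^esub> h = \<one>\<^bsub>G\<^esub>"
    using gh assms h by simp
  then have h_eq: "h = inv\<^bsub>G\<^esub> g"
    using assms h by (metis G.inv_equality G.inv_inv)
  have "e \<sqsubseteq>\<^bsub>E\<^esub> \<theta> g f"
  proof -
    have "e \<sqinter>\<^bsub>E\<^esub> \<theta> g f \<sqsubseteq>\<^bsub>E\<^esub> \<theta> g f"
      using assms f by (intro E.meet_right) auto
    moreover have "e \<sqinter>\<^bsub>E\<^esub> \<theta> g f \<sqinter>\<^bsub>E\<^esub> \<theta> (g \<otimes>\<^bsub>G\<^esub> h) e \<sqsubseteq>\<^bsub>E\<^esub> e \<sqinter>\<^bsub>E\<^esub> \<theta> g f"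
      using assms f h by (intro E.meet_left) auto
    ultimately show ?thesis
      using 1 assms f by (metis E.le_trans E.meet_closed action_closed)
  qed
  then have le1: "\<theta> h e \<sqsubseteq>\<^bsub>E\<^esub> f"
    using action_le_iff assms f h_eq by simp
  have le2: "f \<sqsubseteq>\<^bsub>E\<^esub> \<theta> h e"
  proof -
    have "f \<sqinter>\<^bsub>E\<^esub> \<theta> h e \<sqsubseteq>\<^bsub>E\<^esub> \<theta> h e"
      using assms f h by (intro E.meet_right) auto
    moreover have "f \<sqinter>\<^bsub>E\<^esub> \<theta> h e \<sqinter>\<^bsub>E\<^esub> \<theta> (h \<otimes>\<^bsub>G\<^esub> g) f \<sqsubseteq>\<^bsub>E\<^esub> f \<sqinter>\<^bsub>E\<^esub> \<theta> h e"
      using assms f h by (intro E.meet_left) auto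
    ultimately show ?thesis
      using 2 assms f h by (metis E.le_trans E.meet_closed action_closed)
  qed
  have "f = \<theta> h e"
    using le1 le2 assms f h by (intro E.le_antisym) auto
  with y h_eq show "y = (\<theta> (inv\<^bsub>G\<^esub> g) e, inv\<^bsub>G\<^esub> g)"
    by simp
qed

lemma sginv_semidirect [simp]:
  "\<lbrakk>e \<in> carrier E; g \<in> carrier G\<rbrakk> \<Longrightarrow> sginv S (e, g) = (\<theta> (inv\<^bsub>G\<^esub> g) e, inv\<^bsub>G\<^esub> g)"
  by (simp add: sginv_def is_sginverse_semidirect_iff)

lemma inverse_semigroup_semidirect: "inverse_semigroup S"
proof
  fix x y assume "x \<in> carrier S" "y \<in> carrier S"
  then show "x \<bullet>\<^bsub>S\<^esub> y \<in> carrier S" by auto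
next
  fix x y z assume "x \<in> carrier S" "y \<in> carrier S" "z \<in> carrier S"
  then show "x \<bullet>\<^bsub>S\<^esub> y \<bullet>\<^bsub>S\<^esub> z = x \<bullet>\<^bsub>S\<^esub> (y \<bullet>\<^bsub>S\<^esub> z)"
    by (auto simp: action_meet action_mult meet_assoc G.m_assoc)
next
  fix x assume "x \<in> carrier S"
  then show "\<exists>!y. is_sginverse S x y"
    by (auto simp: is_sginverse_semidirect_iff)
qed

lemma inverse_sg_generate_carrier:
  assumes "A \<subseteq> carrier S" "x \<in> inverse_sg_generate S A"
  shows "x \<in> carrier S"
  using assms(2) by induction (use assms(1) in auto)

text \<open>The generation rules are exactly the closure properties of an inverse subsemigroup, and
  \<open>inverse_sg_generate_carrier\<close> keeps the generated set inside the carrier.\<close>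

lemma fin_gen_inverse_subsemigroup_iff:
  "fin_gen_inverse_subsemigroup T S \<longleftrightarrow>
    (\<exists>A. finite A \<and> A \<subseteq> carrier S \<and> T = inverse_sg_generate S A)"
  using inverse_sg_generate_carrier
  by (auto simp: fin_gen_inverse_subsemigroup_def inverse_subsemigroup_def simp del: carrier_semidirect
      intro: inverse_sg_generate.intros)

section \<open>Subgroups embedded over a fixed element\<close>

lemma generate_fixed:
  assumes "e \<in> carrier E" "A \<subseteq> carrier G" "\<And>g. g \<in> A \<Longrightarrow> \<theta> g e = e" "g \<in> generate G A"
  shows "g \<in> carrier G" "\<theta> g e = e"
  using G.generate_subgroup_incl[OF _ stabilizer_subgroup[OF assms(1)], of A] assms by blast+

text \<open>Over an element fixed by all group components involved, products and inverses in
  \<open>S\<close> leave the first coordinate alone and act as in \<open>G\<close> on the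
  second.\<close>

lemma inverse_sg_generate_fixed:
  assumes e: "e \<in> carrier E" and A: "A \<subseteq> carrier G" "A \<noteq> {}"
    and fixed: "\<And>g. g \<in> A \<Longrightarrow> \<theta> g e = e"
  shows "inverse_sg_generate S ({e} \<times> A) = {e} \<times> generate G A"
proof
  have "x \<in> {e} \<times> generate G A" if "x \<in> inverse_sg_generate S ({e} \<times> A)" for x
    using that
  proof induction
    case (sg_incl x)
    then show ?case by (auto intro: generate.incl)
  next
    case (sg_inv x)
    then obtain g where g: "x = (e, g)" "g \<in> generate G A" by auto
    moreover have "inv\<^bsub>G\<^esub> g \<in> generate G A"
      using G.generate_m_inv_closed[OF A(1) g(2)] .
    moreover from this have "\<theta> (inv\<^bsub>G\<^esub> g) e = e"
      using generate_fixed(2)[OF e A(1) fixed] by blast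
    ultimately show ?case
      using e generate_fixed(1)[OF e A(1) fixed] by simp
  next
    case (sg_mult x y)
    then show ?case
      using e generate_fixed[OF e A(1) fixed] by (auto intro: generate.eng)
  qed
  then show "inverse_sg_generate S ({e} \<times> A) \<subseteq> {e} \<times> generate G A" by blast
next
  have inv_mem: "(e, inv\<^bsub>G\<^esub> a) \<in> inverse_sg_generate S ({e} \<times> A)" if "a \<in> A" for a
  proof -
    have "sginv S (e, a) \<in> inverse_sg_generate S ({e} \<times> A)"
      using that by (intro inverse_sg_generate.intros) auto
    moreover have "\<theta> (inv\<^bsub>G\<^esub> a) e = e"
      using generate_fixed(2)[OF e A(1) fixed generate.inv[OF that]] .
    ultimately show ?thesis
      using that A(1) e by auto
  qed
  have "(e, g) \<in> inverse_sg_generate S ({e} \<times> A)" if "g \<in> generate G A" for g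
    using that
  proof induction
    case one
    \<comment> \<open>Inverse semigroup generation has no rule for a unit, so the identity is
      produced as \<open>a\<close> times its inverse; this is where \<open>A\<close> must be
      nonempty.\<close>
    obtain a where a: "a \<in> A" using A by blast
    then have "(e, a) \<bullet>\<^bsub>S\<^esub> (e, inv\<^bsub>G\<^esub> a) \<in> inverse_sg_generate S ({e} \<times> A)"
      by (intro inverse_sg_generate.sg_mult inv_mem inverse_sg_generate.sg_incl) auto
    moreover have "a \<in> carrier G" using a A by blast
    ultimately show ?case
      using e fixed[OF a] by simp
  next
    case (incl h)
    then show ?case by (auto intro: inverse_sg_generate.sg_incl)
  next
    case (inv h)
    then show ?case by (rule inv_mem)
  next
    case (eng g h)
    then have "(e, g) \<bullet>\<^bsub>S\<^esub> (e, h) \<in> inverse_sg_generate S ({e} \<times> A)"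
      by (intro inverse_sg_generate.sg_mult)
    then show ?case
      using e generate_fixed(2)[OF e A(1) fixed eng(1)] by simp
  qed
  then show "{e} \<times> generate G A \<subseteq> inverse_sg_generate S ({e} \<times> A)" by auto
qed

lemma howson_group_if_howson_semidirect:
  assumes "carrier E \<noteq> {}" "finite (carrier E)" and howson: "howson_inverse_semigroup S"
  shows "howson_group G"
  unfolding howson_group_def
proof (intro conjI allI impI)
  obtain b where b: "b \<in> carrier E" "\<And>g. g \<in> carrier G \<Longrightarrow> \<theta> g b = b"
    using fixed_bottom assms by blast
  have lift: "fin_gen_inverse_subsemigroup ({b} \<times> H) S" if H: "fin_gen_subgroup H G" for H
  proof -
    obtain A where A: "finite A" "A \<noteq> {}" "A \<subseteq> carrier G" "H = generate G A"
      using G.fin_gen_subgroup_nonempty_generators[OF H] by blast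
    then have "{b} \<times> H = inverse_sg_generate S ({b} \<times> A)"
      using inverse_sg_generate_fixed[OF b(1) A(3,2)] b(2) by blast
    with A b show ?thesis
      unfolding fin_gen_inverse_subsemigroup_iff by (intro exI[of _ "{b} \<times> A"]) auto
  qed
  fix H K assume HK: "fin_gen_subgroup H G \<and> fin_gen_subgroup K G"
  then have sub: "subgroup (H \<inter> K) G"
    by (auto simp: fin_gen_subgroup_def intro: G.subgroups_Inter_pair)
  have "fin_gen_inverse_subsemigroup (({b} \<times> H) \<inter> ({b} \<times> K)) S"
    using howson lift HK by (simp add: howson_inverse_semigroup_def)
  moreover have "({b} \<times> H) \<inter> ({b} \<times> K) = {b} \<times> (H \<inter> K)"
    by auto
  ultimately obtain A where A: "finite A" "{b} \<times> (H \<inter> K) = inverse_sg_generate S A"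
    unfolding fin_gen_inverse_subsemigroup_iff by auto
  \<comment> \<open>All elements of \<open>A\<close> have first coordinate \<open>b\<close>, so
    their second coordinates determine \<open>A\<close> and serve as group generators.\<close>
  define Y where "Y = snd ` A"
  have "A \<subseteq> {b} \<times> (H \<inter> K)"
    using A(2) by (auto intro: inverse_sg_generate.sg_incl)
  then have A_eq: "A = {b} \<times> Y" and Y: "Y \<subseteq> H \<inter> K"
    by (force simp: Y_def)+
  have XG: "Y \<subseteq> carrier G"
    using Y subgroup.subset[OF sub] by blast
  \<comment> \<open>Without generators the generated set would be empty, yet it contains
    \<open>b\<close> paired with the identity.\<close>
  have "Y \<noteq> {}"
  proof
    assume "Y = {}"
    then have "inverse_sg_generate S A \<subseteq> {}"
      by (intro inverse_sg_generate_subset) (auto simp: A_eq inverse_subsemigroup_def)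
    with A(2) subgroup.one_closed[OF sub] show False by auto
  qed
  then have "{b} \<times> (H \<inter> K) = {b} \<times> generate G Y"
    using A(2) A_eq inverse_sg_generate_fixed[OF b(1) XG] b(2) XG by blast
  then have "H \<inter> K = generate G Y" by auto
  with sub XG A(1) show "fin_gen_subgroup (H \<inter> K) G"
    by (auto simp: fin_gen_subgroup_def Y_def)
qed (rule G.is_group)

section \<open>Vertex groups and their Schreier generators\<close>

definition vertex_group :: "('e \<times> 'g) set \<Rightarrow> 'e \<Rightarrow> 'g set"
  where "vertex_group T e = {g \<in> carrier G. (e, g) \<in> T \<and> \<theta> g e = e}"

lemma
  assumes "inverse_subsemigroup T S"
  shows subsemigroup_carrier: "(e, g) \<in> T \<Longrightarrow> e \<in> carrier E \<and> g \<in> carrier G"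
    and subsemigroup_mult:
      "\<lbrakk>(e, g) \<in> T; (f, h) \<in> T\<rbrakk> \<Longrightarrow> (e \<sqinter>\<^bsub>E\<^esub> \<theta> g f, g \<otimes>\<^bsub>G\<^esub> h) \<in> T"
    and subsemigroup_inv: "(e, g) \<in> T \<Longrightarrow> (\<theta> (inv\<^bsub>G\<^esub> g) e, inv\<^bsub>G\<^esub> g) \<in> T"
proof -
  show c: "e \<in> carrier E \<and> g \<in> carrier G" if "(e, g) \<in> T" for e g
    using assms that by (auto simp: inverse_subsemigroup_def)
  show "(e \<sqinter>\<^bsub>E\<^esub> \<theta> g f, g \<otimes>\<^bsub>G\<^esub> h) \<in> T" if "(e, g) \<in> T" "(f, h) \<in> T"
    using assms that mult_semidirect unfolding inverse_subsemigroup_def by metis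
  show "(\<theta> (inv\<^bsub>G\<^esub> g) e, inv\<^bsub>G\<^esub> g) \<in> T" if "(e, g) \<in> T"
    using assms that sginv_semidirect c unfolding inverse_subsemigroup_def by metis
qed

lemma vertex_group_subgroup:
  assumes T: "inverse_subsemigroup T S" and e: "(e, \<one>\<^bsub>G\<^esub>) \<in> T"
  shows "subgroup (vertex_group T e) G"
proof -
  have eE: "e \<in> carrier E"
    using subsemigroup_carrier[OF T e] by simp
  show ?thesis
  proof (rule G.subgroupI)
    show "vertex_group T e \<noteq> {}"
      using e eE by (auto simp: vertex_group_def)
  next
    fix g assume g: "g \<in> vertex_group T e"
    then have "\<theta> (inv\<^bsub>G\<^esub> g) e = e"
      using action_inv_left[of g e] eE by (auto simp: vertex_group_def)
    with g show "inv\<^bsub>G\<^esub> g \<in> vertex_group T e"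
      using subsemigroup_inv[OF T, of e g] by (auto simp: vertex_group_def)
  next
    fix g h assume "g \<in> vertex_group T e" "h \<in> vertex_group T e"
    with eE show "g \<otimes>\<^bsub>G\<^esub> h \<in> vertex_group T e"
      using subsemigroup_mult[OF T, of e g e h] by (auto simp: vertex_group_def action_mult)
  qed (auto simp: vertex_group_def)
qed

lemma vertex_group_Int: "vertex_group (T \<inter> U) e = vertex_group T e \<inter> vertex_group U e"
  by (auto simp: vertex_group_def)

text \<open>
  Schreier's argument: \<open>t f\<close> is a transversal of arrows from \<open>f\<close> to \<open>e\<close>, and every element of \<open>T\<close> that
  can be restricted to the connected component of \<open>e\<close> contributes \<open>t f \<cdot> g \<cdot> (t (g\<^sup>-\<^sup>1f))\<^sup>-\<^sup>1\<close>; it is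
  enough to take these for the generators of \<open>T\<close>.
\<close>

lemma fin_gen_vertex_group:
  assumes fin: "finite (carrier E)" and T: "fin_gen_inverse_subsemigroup T S"
    and e1: "(e, \<one>\<^bsub>G\<^esub>) \<in> T"
  shows "fin_gen_subgroup (vertex_group T e) G"
proof -
  obtain A where A: "finite A" "A \<subseteq> carrier S" "T = inverse_sg_generate S A"
    using T by (auto simp: fin_gen_inverse_subsemigroup_def)
  have T': "inverse_subsemigroup T S"
    using T by (simp add: fin_gen_inverse_subsemigroup_def)
  note carr = subsemigroup_carrier[OF T'] and mult = subsemigroup_mult[OF T']
    and inv = subsemigroup_inv[OF T']
  have eE: "e \<in> carrier E" using carr[OF e1] by simp
  \<comment> \<open>The connected component of \<open>e\<close>: the sources of arrows of
    \<open>T\<close> with target \<open>e\<close>.\<close>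
  define Orb where "Orb = {f \<in> carrier E. \<exists>u. (e, u) \<in> T \<and> \<theta> u f = e}"
  define t where "t f = (if f = e then \<one>\<^bsub>G\<^esub> else SOME u. (e, u) \<in> T \<and> \<theta> u f = e)" for f
  have t: "(e, t f) \<in> T" "\<theta> (t f) f = e" "t f \<in> carrier G" if "f \<in> Orb" for f
  proof -
    have "\<exists>u. (e, u) \<in> T \<and> \<theta> u f = e"
      using that by (simp add: Orb_def)
    from someI_ex[OF this] show "(e, t f) \<in> T" "\<theta> (t f) f = e"
      using e1 eE by (auto simp: t_def)
    then show "t f \<in> carrier G" using carr by blast
  qed
  have Orb_E: "f \<in> carrier E" if "f \<in> Orb" for f
    using that by (simp add: Orb_def)
  \<comment> \<open>If \<open>f\<close> lies below \<open>a\<close>, applying \<open>t f\<close>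
    puts \<open>e\<close> below \<open>\<theta> (t f) a\<close>. The meet in the product of
    \<open>(e, t f)\<close> and \<open>(a, g)\<close> is therefore \<open>e\<close>, and the
    restricted arrow stays in the component.\<close>
  have arrow: "(e, t f \<otimes>\<^bsub>G\<^esub> g) \<in> T" "\<theta> (inv\<^bsub>G\<^esub> g) f \<in> Orb"
    if f: "f \<in> Orb" "f \<sqsubseteq>\<^bsub>E\<^esub> a" and a: "(a, g) \<in> T" for f a g
  proof -
    have c: "a \<in> carrier E" "g \<in> carrier G" using carr[OF a] by auto
    have "e \<sqsubseteq>\<^bsub>E\<^esub> \<theta> (t f) a"
      using action_mono[OF t(3)[OF f(1)] Orb_E[OF f(1)] c(1) f(2)] t(2)[OF f(1)] by simp
    then have "e \<sqinter>\<^bsub>E\<^esub> \<theta> (t f) a = e"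
      using le_iff_meet_eq[OF eE] c t(3)[OF f(1)] by auto
    then show *: "(e, t f \<otimes>\<^bsub>G\<^esub> g) \<in> T"
      using mult[OF t(1)[OF f(1)] a] by simp
    moreover have "\<theta> (t f \<otimes>\<^bsub>G\<^esub> g) (\<theta> (inv\<^bsub>G\<^esub> g) f) = e"
      using c t[OF f(1)] Orb_E[OF f(1)] by (simp add: action_mult)
    ultimately show "\<theta> (inv\<^bsub>G\<^esub> g) f \<in> Orb"
      using c Orb_E[OF f(1)] unfolding Orb_def by blast
  qed
  \<comment> \<open>The loop depends only on \<open>f\<close> and \<open>g\<close>; the first
    coordinate \<open>a\<close> of an element \<open>(a, g)\<close> only decides whether it
    restricts to \<open>f\<close>.\<close>
  define s where "s f g = t f \<otimes>\<^bsub>G\<^esub> g \<otimes>\<^bsub>G\<^esub> inv\<^bsub>G\<^esub> (t (\<theta> (inv\<^bsub>G\<^esub> g) f))" for f g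
  have s: "s f g \<in> vertex_group T e" if f: "f \<in> Orb" "f \<sqsubseteq>\<^bsub>E\<^esub> a" and a: "(a, g) \<in> T" for f a g
  proof -
    have c: "a \<in> carrier E" "g \<in> carrier G" using carr[OF a] by auto
    define f' where "f' = \<theta> (inv\<^bsub>G\<^esub> g) f"
    have f': "f' \<in> Orb" using arrow(2)[OF f a] by (simp add: f'_def)
    have gf': "\<theta> g f' = f"
      using c Orb_E[OF f(1)] by (simp add: f'_def)
    have it: "\<theta> (inv\<^bsub>G\<^esub> (t f')) e = f'"
      using t[OF f'] Orb_E[OF f'] action_inv_left by metis
    have fix_e: "\<theta> (t f \<otimes>\<^bsub>G\<^esub> g) f' = e"
      using c t[OF f(1)] Orb_E[OF f'] gf' by (simp add: action_mult)
    have "(e, s f g) \<in> T"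
      using mult[OF arrow(1)[OF f a] inv[OF t(1)[OF f']]] it fix_e eE
      by (simp add: s_def f'_def)
    moreover have "\<theta> (s f g) e = e"
      unfolding s_def f'_def[symmetric]
      using c t(3)[OF f(1)] t(3)[OF f'] eE it fix_e by (simp add: action_mult)
    ultimately show ?thesis
      using carr by (auto simp: vertex_group_def)
  qed
  define Y where "Y = {s f g | f a g. (a, g) \<in> A \<and> f \<in> Orb \<and> f \<sqsubseteq>\<^bsub>E\<^esub> a}"
  \<comment> \<open>Finiteness of \<open>E\<close> bounds the number of base points \<open>f\<close>
    per generator.\<close>
  have "Y \<subseteq> (\<lambda>(f, a, g). s f g) ` (carrier E \<times> A)"
    using Orb_E by (force simp: Y_def)
  then have Y_fin: "finite Y"
    by (rule finite_subset) (use fin A in simp)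
  have Y_sub: "Y \<subseteq> vertex_group T e"
    using s by (auto simp: Y_def A(3) intro: inverse_sg_generate.sg_incl)
  then have Y_G: "Y \<subseteq> carrier G" by (auto simp: vertex_group_def)
  \<comment> \<open>The claim is made for all base points at once because inverses and products move
    them: \<open>s\<close> satisfies a cocycle rule along the action.\<close>
  have gen: "\<forall>f \<in> Orb. f \<sqsubseteq>\<^bsub>E\<^esub> fst x \<longrightarrow> s f (snd x) \<in> generate G Y"
    if "x \<in> inverse_sg_generate S A" for x
    using that
  proof induction
    case (sg_incl x)
    then show ?case
      by (cases x) (auto simp: Y_def intro!: generate.incl)
  next
    case (sg_inv x)
    obtain a g where x: "x = (a, g)" by (cases x)
    have aT: "(a, g) \<in> T" using sg_inv(1) A(3) x by simp
    then have c: "a \<in> carrier E" "g \<in> carrier G" using carr by auto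
    show ?case
    proof (intro ballI impI)
      fix f assume f: "f \<in> Orb" "f \<sqsubseteq>\<^bsub>E\<^esub> fst (sginv S x)"
      then have le: "f \<sqsubseteq>\<^bsub>E\<^esub> \<theta> (inv\<^bsub>G\<^esub> g) a" using c x by simp
      have O': "\<theta> g f \<in> Orb"
        using arrow(2)[OF f(1) le inv[OF aT]] c by simp
      have "\<theta> g f \<sqsubseteq>\<^bsub>E\<^esub> a"
        using action_le_iff[of "inv\<^bsub>G\<^esub> g" f a] le c Orb_E[OF f(1)] by simp
      with O' sg_inv.IH x have "s (\<theta> g f) g \<in> generate G Y" by simp
      then have "inv\<^bsub>G\<^esub> (s (\<theta> g f) g) \<in> generate G Y"
        by (rule G.generate_m_inv_closed[OF Y_G])
      moreover have "inv\<^bsub>G\<^esub> (s (\<theta> g f) g) = s f (inv\<^bsub>G\<^esub> g)"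
        using c t(3)[OF f(1)] t(3)[OF O'] Orb_E[OF f(1)]
        by (simp add: s_def G.inv_mult_group G.m_assoc)
      ultimately show "s f (snd (sginv S x)) \<in> generate G Y"
        using c x by simp
    qed
  next
    case (sg_mult x y)
    obtain a g b h where x: "x = (a, g)" and y: "y = (b, h)" by (cases x, cases y)
    have aT: "(a, g) \<in> T" "(b, h) \<in> T" using sg_mult(1,2) A(3) x y by auto
    then have c: "a \<in> carrier E" "g \<in> carrier G" "b \<in> carrier E" "h \<in> carrier G"
      using carr by auto
    show ?case
    proof (intro ballI impI)
      fix f assume f: "f \<in> Orb" "f \<sqsubseteq>\<^bsub>E\<^esub> fst (x \<bullet>\<^bsub>S\<^esub> y)"
      have fE: "f \<in> carrier E" using Orb_E f by blast
      \<comment> \<open>Being below this meet lets the first factor restrict to \<open>f\<close> and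
        the second to the source of the restricted first factor.\<close>
      have le: "f \<sqsubseteq>\<^bsub>E\<^esub> a \<sqinter>\<^bsub>E\<^esub> \<theta> g b" using f x y by simp
      have le1: "f \<sqsubseteq>\<^bsub>E\<^esub> a"
        using E.le_trans[OF le E.meet_left] c fE by auto
      have "f \<sqsubseteq>\<^bsub>E\<^esub> \<theta> g b"
        using E.le_trans[OF le E.meet_right] c fE by auto
      then have le2: "\<theta> (inv\<^bsub>G\<^esub> g) f \<sqsubseteq>\<^bsub>E\<^esub> b"
        using action_le_iff c fE by blast
      have O': "\<theta> (inv\<^bsub>G\<^esub> g) f \<in> Orb"
        using arrow(2)[OF f(1) le1 aT(1)] .
      have O'': "\<theta> (inv\<^bsub>G\<^esub> h) (\<theta> (inv\<^bsub>G\<^esub> g) f) \<in> Orb"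
        using arrow(2)[OF O' le2 aT(2)] .
      have "s f g \<otimes>\<^bsub>G\<^esub> s (\<theta> (inv\<^bsub>G\<^esub> g) f) h \<in> generate G Y"
        using sg_mult.IH f(1) le1 O' le2 x y by (auto intro: generate.eng)
      \<comment> \<open>The product telescopes: the transversal element at the intermediate vertex
        cancels.\<close>
      moreover have "s f g \<otimes>\<^bsub>G\<^esub> s (\<theta> (inv\<^bsub>G\<^esub> g) f) h = s f (g \<otimes>\<^bsub>G\<^esub> h)"
      proof -
        have "inv\<^bsub>G\<^esub> t (\<theta> (inv\<^bsub>G\<^esub> g) f) \<otimes>\<^bsub>G\<^esub> (t (\<theta> (inv\<^bsub>G\<^esub> g) f) \<otimes>\<^bsub>G\<^esub> z) = z"
          if "z \<in> carrier G" for z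
          using that t(3)[OF O'] by (simp add: G.m_assoc[symmetric])
        then show ?thesis
          using c fE t(3)[OF f(1)] t(3)[OF O'] t(3)[OF O'']
          by (simp add: s_def G.inv_mult_group action_mult G.m_assoc)
      qed
      ultimately show "s f (snd (x \<bullet>\<^bsub>S\<^esub> y)) \<in> generate G Y"
        using x y by simp
    qed
  qed
  have sub: "subgroup (vertex_group T e) G"
    by (rule vertex_group_subgroup[OF T' e1])
  have "e \<in> Orb"
    using e1 eE by (auto simp: Orb_def)
  have "vertex_group T e \<subseteq> generate G Y"
  proof
    fix g assume g: "g \<in> vertex_group T e"
    then have gG: "g \<in> carrier G" and gT: "(e, g) \<in> T" and ge: "\<theta> g e = e"
      by (auto simp: vertex_group_def)
    have "s e g \<in> generate G Y"
      using gen[of "(e, g)"] gT A(3) \<open>e \<in> Orb\<close> eE by simp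
    moreover have "\<theta> (inv\<^bsub>G\<^esub> g) e = e"
      using ge gG eE action_inv_left by metis
    ultimately show "g \<in> generate G Y"
      using gG by (simp add: s_def t_def)
  qed
  then have "vertex_group T e = generate G Y"
    using G.generate_subgroup_incl[OF Y_sub sub] by blast
  with sub Y_fin Y_G show ?thesis
    by (auto simp: fin_gen_subgroup_def)
qed

section \<open>Finite generation from the vertex groups\<close>

text \<open>An arrow with target \<open>e\<close> and source \<open>f\<close> is a vertex group
  element at \<open>e\<close> times one chosen arrow from \<open>f\<close> to \<open>e\<close>.
  Finiteness of \<open>E\<close> leaves finitely many chosen arrows and finitely many vertex
  groups.\<close>

lemma fin_gen_if_fin_gen_vertex_groups:
  assumes fin: "finite (carrier E)" and V: "inverse_subsemigroup V S"
    and fg: "\<And>e. (e, \<one>\<^bsub>G\<^esub>) \<in> V \<Longrightarrow> fin_gen_subgroup (vertex_group V e) G"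
  shows "fin_gen_inverse_subsemigroup V S"
proof -
  note carr = subsemigroup_carrier[OF V] and mult = subsemigroup_mult[OF V]
    and inv = subsemigroup_inv[OF V]
  have "\<forall>e. \<exists>Y. (e, \<one>\<^bsub>G\<^esub>) \<in> V \<longrightarrow>
      finite Y \<and> Y \<noteq> {} \<and> Y \<subseteq> carrier G \<and> vertex_group V e = generate G Y"
    using fg G.fin_gen_subgroup_nonempty_generators by metis
  then obtain Y where Y: "finite (Y e)" "Y e \<noteq> {}" "Y e \<subseteq> carrier G"
      "vertex_group V e = generate G (Y e)" if "(e, \<one>\<^bsub>G\<^esub>) \<in> V" for e
    by metis
  define t where "t e f = (SOME g. (e, g) \<in> V \<and> \<theta> (inv\<^bsub>G\<^esub> g) e = f)" for e f
  define D where "D = {e. (e, \<one>\<^bsub>G\<^esub>) \<in> V}"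
  \<comment> \<open>The intersection with \<open>V\<close> applies to the chosen arrows only. It
    guards against pairs with no connecting arrow, where \<open>t e f\<close> is an arbitrary
    value.\<close>
  define B where "B = Sigma D Y \<union> (\<lambda>(e, f). (e, t e f)) ` (carrier E \<times> carrier E) \<inter> V"
  have "D \<subseteq> carrier E" using carr by (auto simp: D_def)
  then have "finite D" using fin by (rule finite_subset)
  then have B_fin: "finite B"
    using Y(1) fin by (auto simp: B_def D_def)
  have B_V: "B \<subseteq> V"
  proof -
    have "(e, g) \<in> V" if "e \<in> D" "g \<in> Y e" for e g
    proof -
      have "g \<in> vertex_group V e"
        using that Y(4) by (auto simp: D_def intro: generate.incl)
      then show ?thesis by (simp add: vertex_group_def)
    qed
    then show ?thesis by (auto simp: B_def)
  qed
  have "(e, g) \<in> inverse_sg_generate S B" if eg: "(e, g) \<in> V" for e g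
  proof -
    have c: "e \<in> carrier E" "g \<in> carrier G" using carr[OF eg] by auto
    have e1: "(e, \<one>\<^bsub>G\<^esub>) \<in> V"
      using mult[OF eg inv[OF eg]] c by simp
    define f where "f = \<theta> (inv\<^bsub>G\<^esub> g) e"
    define u where "u = t e f"
    have f: "f \<in> carrier E" using c by (simp add: f_def)
    have "(e, u) \<in> V \<and> \<theta> (inv\<^bsub>G\<^esub> u) e = f"
      unfolding u_def t_def by (rule someI[of _ g]) (use eg in \<open>simp add: f_def\<close>)
    then have u: "(e, u) \<in> V" "\<theta> (inv\<^bsub>G\<^esub> u) e = f" by auto
    then have uG: "u \<in> carrier G" using carr by blast
    have gf: "\<theta> g f = e" using c by (simp add: f_def)
    \<comment> \<open>Both arrows run from \<open>f\<close> to \<open>e\<close>, so going back along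
      \<open>u\<close> and forward along \<open>g\<close> is a loop at \<open>e\<close>.\<close>
    have k: "g \<otimes>\<^bsub>G\<^esub> inv\<^bsub>G\<^esub> u \<in> vertex_group V e"
      using mult[OF eg inv[OF u(1)]] c uG u(2) gf by (simp add: vertex_group_def action_mult)
    have fixed: "\<theta> x e = e" if "x \<in> Y e" for x
    proof -
      have "x \<in> vertex_group V e"
        using that Y(4)[OF e1] by (auto intro: generate.incl)
      then show ?thesis by (simp add: vertex_group_def)
    qed
    have "{e} \<times> vertex_group V e = inverse_sg_generate S ({e} \<times> Y e)"
      using inverse_sg_generate_fixed[OF c(1) Y(3,2)[OF e1] fixed] Y(4)[OF e1] by simp
    also have "\<dots> \<subseteq> inverse_sg_generate S B"
      by (rule inverse_sg_generate_mono) (use e1 in \<open>auto simp: B_def D_def\<close>)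
    finally have "(e, g \<otimes>\<^bsub>G\<^esub> inv\<^bsub>G\<^esub> u) \<in> inverse_sg_generate S B"
      using k by blast
    moreover have "(e, u) \<in> inverse_sg_generate S B"
      by (rule inverse_sg_generate.sg_incl) (use u c f in \<open>auto simp: B_def u_def\<close>)
    ultimately have "(e, g \<otimes>\<^bsub>G\<^esub> inv\<^bsub>G\<^esub> u) \<bullet>\<^bsub>S\<^esub> (e, u) \<in> inverse_sg_generate S B"
      by (rule inverse_sg_generate.sg_mult)
    then show ?thesis
      using k c uG by (simp add: vertex_group_def G.m_assoc)
  qed
  then have "V = inverse_sg_generate S B"
    using inverse_sg_generate_subset[OF V B_V] by auto
  moreover have "B \<subseteq> carrier S"
    using B_V V by (auto simp: inverse_subsemigroup_def)
  ultimately show ?thesis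
    using B_fin unfolding fin_gen_inverse_subsemigroup_iff by blast
qed

text \<open>A vertex of \<open>T \<inter> U\<close> is a vertex of both \<open>T\<close> and
  \<open>U\<close>, so its vertex group is an intersection of two finitely generated subgroups. An
  empty intersection has no vertices and is covered as well.\<close>

lemma howson_semidirect_if_howson_group:
  assumes fin: "finite (carrier E)" and howson: "howson_group G"
  shows "howson_inverse_semigroup S"
  unfolding howson_inverse_semigroup_def
proof (intro conjI allI impI)
  fix T U assume TU: "fin_gen_inverse_subsemigroup T S \<and> fin_gen_inverse_subsemigroup U S"
  show "fin_gen_inverse_subsemigroup (T \<inter> U) S"
  proof (rule fin_gen_if_fin_gen_vertex_groups[OF fin])
    show "inverse_subsemigroup (T \<inter> U) S"
      using TU by (auto simp: fin_gen_inverse_subsemigroup_def inverse_subsemigroup_def)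
  next
    fix e assume "(e, \<one>\<^bsub>G\<^esub>) \<in> T \<inter> U"
    then show "fin_gen_subgroup (vertex_group (T \<inter> U) e) G"
      using howson TU fin_gen_vertex_group[OF fin] by (simp add: vertex_group_Int howson_group_def)
  qed
qed (rule inverse_semigroup_semidirect)

end

theorem theorem3p4:
  fixes E :: "('e, 'm) gorder_scheme"
    and G :: "('g, 'n) monoid_scheme"
    and \<theta> :: "'g \<Rightarrow> 'e \<Rightarrow> 'e"
  assumes "lower_semilattice E"
    and "carrier E \<noteq> {}"
    and "finite (carrier E)"
    and "group G"
    and "\<theta> \<in> hom G (Semilattice_Aut E)"
  shows "howson_inverse_semigroup (semidirect_product E \<theta> G) \<longleftrightarrow> howson_group G"
proof -
  interpret semilattice_action E G \<theta>
    using assms by (simp add: semilattice_action_def semilattice_action_axioms_def)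
  show ?thesis
    using howson_group_if_howson_semidirect howson_semidirect_if_howson_group assms(2,3) by blast
qed

end
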